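(* Let $\mathcal{H}$ be an infinite dimensional complex Hilbert space, let $A,B\in B(\mathcal{H})$ be Drazin invertible, let $X,Y\in B(\mathcal{H})$ and let $m,n\ge1$ be integers. If $A$ is $(X,m)$-isometric, $B$ is $(Y,n)$-isometric and $$[X,Y]=[A,B]=[A^*,Y]=[B^*,X]=0=AB,$$ then $A+B$ is $(XY,m+n-1)$-isometric and $\left((A+B)_d^*,A+B\right)\in(XY,m+n-1)$-adjoint.
   Context: $B(\mathcal{H})$ is the algebra of bounded linear operators on $\mathcal{H}$, and $[S,T]=ST-TS$. For $S,T,Z\in B(\mathcal{H})$ and an integer $m\ge 1$ put $$\triangle_{S,T}^m(Z)=\sum_{j=0}^m(-1)^j\binom{m}{j}S^{m-j}ZT^{m-j},\qquad \delta_{S,T}^m(Z)=\sum_{j=0}^m(-1)^j\binom{m}{j}S^{m-j}ZT^{j}.$$ $T$ is $(Z,m)$-isometric if $\triangle_{T^*,T}^m(Z)=0$; $(S,T)\in(Z,m)$-adjoint if $\delta_{S,T}^m(Z)=0$. $A$ is Drazin invertible, with Drazin inverse $A_d\in B(\mathcal{H})$, if $A_dA=AA_d$, $A_d^2A=A_d$ and $A^{p+1}A_d=A^p$ for some integer $p\ge1$. It is a known fact that if $A,B$ are commuting Drazin invertible operators with $AB=0$ then $A+B$ is Drazin invertible; $(A+B)_d$ is its Drazin inverse and $(A+B)_d^*=((A+B)_d)^*$. *)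

theory Defs
  imports "HOL-Analysis.Analysis"
begin

section \<open>Complex Hilbert spaces\<close>

text \<open>
  The inner product is linear in its first argument. The norm, metric and topology, as well as
  positive definiteness, come from the underlying real inner product space, whose inner product
  is the real part of the complex one.
\<close>

class complex_inner = real_inner +
  fixes scaleC :: "complex \<Rightarrow> 'a \<Rightarrow> 'a"  (infixr \<open>*\<^sub>C\<close> 75)
    and cinner :: "'a \<Rightarrow> 'a \<Rightarrow> complex"
  assumes scaleC_add_right: "c *\<^sub>C (x + y) = c *\<^sub>C x + c *\<^sub>C y"
    and scaleC_add_left: "(c + d) *\<^sub>C x = c *\<^sub>C x + d *\<^sub>C x"
    and scaleC_scaleC: "c *\<^sub>C (d *\<^sub>C x) = (c * d) *\<^sub>C x"
    and scaleC_of_real: "complex_of_real r *\<^sub>C x = r *\<^sub>R x"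
    and cinner_add_left: "cinner (x + y) z = cinner x z + cinner y z"
    and cinner_scaleC_left: "cinner (c *\<^sub>C x) y = c * cinner x y"
    and cinner_commute: "cinner x y = cnj (cinner y x)"
    and inner_eq_Re_cinner: "inner x y = Re (cinner x y)"

class chilbert_space = complex_inner + complete_space

global_interpretation complex_vector:
  vector_space "scaleC :: complex \<Rightarrow> 'a::complex_inner \<Rightarrow> 'a"
proof
  show "1 *\<^sub>C x = x" for x :: 'a
    using scaleC_of_real[of 1 x] by simp
qed (simp_all add: scaleC_add_right scaleC_add_left scaleC_scaleC)

lemma scaleC_scaleR: "c *\<^sub>C (r *\<^sub>R x) = r *\<^sub>R (c *\<^sub>C x)"
  for x :: "'a::complex_inner"
  by (metis scaleC_of_real scaleC_scaleC mult.commute)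

lemma cinner_self: "cinner x x = complex_of_real ((norm x)\<^sup>2)"
  for x :: "'a::complex_inner"
proof (rule complex_eqI)
  show "Im (cinner x x) = Im (complex_of_real ((norm x)\<^sup>2))"
    using cinner_commute[of x x] by (simp add: complex_eq_iff)
qed (simp add: inner_eq_Re_cinner[symmetric] power2_norm_eq_inner)


section \<open>The algebra of bounded complex-linear operators\<close>

definition bounded_clinear :: "('a::complex_inner \<Rightarrow> 'a) \<Rightarrow> bool" where
  "bounded_clinear T \<longleftrightarrow> bounded_linear T \<and> (\<forall>c x. T (c *\<^sub>C x) = c *\<^sub>C T x)"

typedef (overloaded) 'a bop = "{T :: 'a::complex_inner \<Rightarrow> 'a. bounded_clinear T}"
  morphisms bop_apply Abs_bop
  by (rule exI[of _ "\<lambda>x. 0"]) (simp add: bounded_clinear_def)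

setup_lifting type_definition_bop

text \<open>
  Multiplication is composition. No instance of \<^class>\<open>ring_1\<close> is possible, because
  \<open>0 \<noteq> 1\<close> fails for operators on the zero space.
\<close>

instantiation bop :: (complex_inner) "{real_algebra, monoid_mult}"
begin

lift_definition zero_bop :: "'a bop" is "\<lambda>x. 0"
  by (simp add: bounded_clinear_def)

lift_definition one_bop :: "'a bop" is "\<lambda>x. x"
  by (simp add: bounded_clinear_def)

lift_definition plus_bop :: "'a bop \<Rightarrow> 'a bop \<Rightarrow> 'a bop" is "\<lambda>S T x. S x + T x"
  by (simp add: bounded_clinear_def bounded_linear_add scaleC_add_right)

lift_definition uminus_bop :: "'a bop \<Rightarrow> 'a bop" is "\<lambda>T x. - T x"
  by (simp add: bounded_clinear_def bounded_linear_minus)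

lift_definition minus_bop :: "'a bop \<Rightarrow> 'a bop \<Rightarrow> 'a bop" is "\<lambda>S T x. S x - T x"
  by (simp add: bounded_clinear_def bounded_linear_sub complex_vector.scale_right_diff_distrib)

lift_definition times_bop :: "'a bop \<Rightarrow> 'a bop \<Rightarrow> 'a bop" is "\<lambda>S T x. S (T x)"
  by (simp add: bounded_clinear_def bounded_linear_compose)

lift_definition scaleR_bop :: "real \<Rightarrow> 'a bop \<Rightarrow> 'a bop" is "\<lambda>r T x. r *\<^sub>R T x"
  by (simp add: bounded_clinear_def bounded_linear_const_scaleR scaleC_scaleR)

instance
  by standard (transfer; force simp: bounded_clinear_def algebra_simps
      dest: bounded_linear.linear simp: linear_add linear_scale)+

end

definition adj :: "'a::chilbert_space bop \<Rightarrow> 'a bop" where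
  "adj T = (THE S. \<forall>x y. cinner (bop_apply T x) y = cinner x (bop_apply S y))"

definition commutator :: "'a::ring \<Rightarrow> 'a \<Rightarrow> 'a" where
  "commutator S T = S * T - T * S"


section \<open>Isometric and adjoint conditions\<close>

definition triangle_op :: "nat \<Rightarrow> 'a::complex_inner bop \<Rightarrow> 'a bop \<Rightarrow> 'a bop \<Rightarrow> 'a bop" where
  "triangle_op m S T Z =
    (\<Sum>j=0..m. ((- 1) ^ j * real (m choose j)) *\<^sub>R (S ^ (m - j) * Z * T ^ (m - j)))"

definition delta_op :: "nat \<Rightarrow> 'a::complex_inner bop \<Rightarrow> 'a bop \<Rightarrow> 'a bop \<Rightarrow> 'a bop" where
  "delta_op m S T Z =
    (\<Sum>j=0..m. ((- 1) ^ j * real (m choose j)) *\<^sub>R (S ^ (m - j) * Z * T ^ j))"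

definition m_isometric :: "'a::chilbert_space bop \<Rightarrow> nat \<Rightarrow> 'a bop \<Rightarrow> bool" where
  "m_isometric Z m T \<longleftrightarrow> triangle_op m (adj T) T Z = 0"

definition m_adjoint :: "'a::complex_inner bop \<Rightarrow> nat \<Rightarrow> 'a bop \<Rightarrow> 'a bop \<Rightarrow> bool" where
  "m_adjoint Z m S T \<longleftrightarrow> delta_op m S T Z = 0"


section \<open>Drazin inverses\<close>

definition is_drazin_inverse :: "'a::monoid_mult \<Rightarrow> 'a \<Rightarrow> bool" where
  "is_drazin_inverse A D \<longleftrightarrow>
    D * A = A * D \<and> D ^ 2 * A = D \<and> (\<exists>p\<ge>1. A ^ (p + 1) * D = A ^ p)"

definition drazin_invertible :: "'a::monoid_mult \<Rightarrow> bool" where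
  "drazin_invertible A \<longleftrightarrow> (\<exists>D. is_drazin_inverse A D)"

definition drazin_inverse :: "'a::monoid_mult \<Rightarrow> 'a" where
  "drazin_inverse A = (THE D. is_drazin_inverse A D)"

text \<open>
  The definite description is justified by uniqueness; the last lemma shows that it denotes for
  the sum of two commuting Drazin invertible elements with product zero.
\<close>

lemma is_drazin_inverse_power:
  assumes "is_drazin_inverse A D"
  shows "D ^ Suc k * A ^ k = D"
proof (induction k)
  case (Suc k)
  have DA: "D * A = A * D" and DDA: "D * D * A = D"
    using assms by (auto simp: is_drazin_inverse_def power2_eq_square)
  have "D ^ Suc (Suc k) * A ^ Suc k = D ^ k * (D * D * A) * A ^ k"
    by (simp only: power_Suc2[of D] power_Suc[of A] mult.assoc)
  also have "\<dots> = D"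
    using Suc by (simp add: DDA power_Suc2 del: power_Suc)
  finally show ?case .
qed simp

lemma power_mult_drazin_inverse:
  fixes A D :: "'a::monoid_mult"
  assumes "A ^ (p + 1) * D = A ^ p" and "p \<le> r"
  shows "A ^ (r + 1) * D = A ^ r"
proof -
  obtain k where r: "r = k + p"
    using assms(2) by (metis le_add_diff_inverse2)
  show ?thesis
    using assms(1) unfolding r by (metis add.assoc mult.assoc power_add)
qed

lemma is_drazin_inverse_unique:
  fixes A D E :: "'a::monoid_mult"
  assumes D: "is_drazin_inverse A D" and E: "is_drazin_inverse A E"
  shows "D = E"
proof -
  obtain p q where p: "A ^ (p + 1) * D = A ^ p" and q: "A ^ (q + 1) * E = A ^ q"
    using D E by (auto simp: is_drazin_inverse_def)
  define r where "r = p + q"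
  have rD: "A ^ (r + 1) * D = A ^ r" and rE: "A ^ (r + 1) * E = A ^ r"
    by (rule power_mult_drazin_inverse[OF p] power_mult_drazin_inverse[OF q]; simp add: r_def)+
  have DA: "D * A = A * D" and EA: "E * A = A * E"
    using D E by (auto simp: is_drazin_inverse_def)
  have DAk: "D * A ^ k = A ^ k * D" and EAk: "E ^ Suc k * A = A * E ^ Suc k" for k
    using power_commuting_commutes[of A D k] power_commuting_commutes[of E A "Suc k"] DA EA by auto
  have EE: "A ^ k * E ^ Suc k = E" for k
    using is_drazin_inverse_power[OF E, of k] EA
    by (metis power_commuting_commutes)
  have "D = D ^ Suc r * (A ^ (r + 1) * E)"
    using is_drazin_inverse_power[OF D, of r] rE by simp
  also have "\<dots> = (D ^ Suc r * A ^ r) * A * E"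
    by (simp add: power_Suc2 mult.assoc del: power_Suc)
  also have "\<dots> = D * A * E"
    by (simp only: is_drazin_inverse_power[OF D])
  finally have 1: "D = D * A * E" .
  have "E = (D * A ^ (r + 1)) * E ^ Suc r"
    using EE[of r] rD DAk[of "r + 1"] by simp
  also have "\<dots> = D * A * (A ^ r * E ^ Suc r)"
    by (simp add: mult.assoc)
  also have "\<dots> = D * A * E"
    by (simp only: EE)
  finally show ?thesis
    using 1 by simp
qed

lemma drazin_inverse_eqI: "is_drazin_inverse A D \<Longrightarrow> drazin_inverse A = D"
  unfolding drazin_inverse_def by (blast intro: is_drazin_inverse_unique)

lemma is_drazin_inverse_add:
  fixes A B D E :: "'a::{ring, monoid_mult}"
  assumes D: "is_drazin_inverse A D" and E: "is_drazin_inverse B E"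
    and AB: "A * B = 0" and BA: "B * A = 0"
  shows "is_drazin_inverse (A + B) (D + E)"
proof -
  obtain p q where p: "A ^ (p + 1) * D = A ^ p" "p \<ge> 1" and q: "B ^ (q + 1) * E = B ^ q"
    using D E by (auto simp: is_drazin_inverse_def)
  have DA: "D * A = A * D" and EB: "E * B = B * E"
    and DDA: "D * D * A = D" and EEB: "E * E * B = E"
    using D E by (auto simp: is_drazin_inverse_def power2_eq_square)
  have DB: "D * B = 0" and BD: "B * D = 0"
    using DDA DA AB BA by (metis mult.assoc mult_zero_left mult_zero_right)+
  have EA: "E * A = 0" and AE: "A * E = 0"
    using EEB EB AB BA by (metis mult.assoc mult_zero_left mult_zero_right)+
  have DE: "D * E = 0" and ED: "E * D = 0"
    using DDA EEB DA EB DB EA AE BD by (metis mult.assoc mult_zero_left mult_zero_right)+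
  have pow: "(A + B) ^ Suc k = A ^ Suc k + B ^ Suc k" for k
  proof (induction k)
    case (Suc k)
    have "A * B ^ Suc k = 0" "B * A ^ Suc k = 0"
      using AB BA by (simp_all add: mult.assoc[symmetric])
    with Suc show ?case
      by (subst (1 2 3) power_Suc) (simp add: algebra_simps del: power_Suc)
  qed simp
  define r where "r = p + q"
  have rD: "A ^ (r + 1) * D = A ^ r" and rE: "B ^ (r + 1) * E = B ^ r"
    by (rule power_mult_drazin_inverse[OF p(1)] power_mult_drazin_inverse[OF q]; simp add: r_def)+
  obtain k where k: "r = Suc k"
    using p(2) by (cases r) (auto simp: r_def)
  have "A ^ (r + 1) * E = 0" "B ^ (r + 1) * D = 0"
    using AE BD by (simp_all add: power_Suc2 mult.assoc del: power_Suc)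
  then have "(A + B) ^ (r + 1) * (D + E) = (A + B) ^ r"
    using rD rE pow[of r] pow[of k] k by (simp add: algebra_simps del: power_Suc)
  moreover have "r \<ge> 1"
    using p(2) by (simp add: r_def)
  ultimately show ?thesis
    unfolding is_drazin_inverse_def
    using DA EB DDA EEB DB BD EA AE DE ED
    by (auto simp: algebra_simps power2_eq_square intro!: exI[of _ r])
qed

lemma drazin_invertible_add:
  fixes A B :: "'a::{ring, monoid_mult}"
  assumes "drazin_invertible A" and "drazin_invertible B"
    and "commutator A B = 0" and "A * B = 0"
  shows "drazin_invertible (A + B)"
  using assms is_drazin_inverse_add unfolding drazin_invertible_def commutator_def by fastforce

end

theory Submission
  imports Defs
begin

text \<open>
  The hypotheses force \<^term>\<open>X * Y = 0\<close>, and both conclusions are linear in \<^term>\<open>X * Y\<close>.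
  In \<open>\<triangle>\<^sup>m(Z) = 0\<close> the term without powers of the operator is \<open>\<plusminus>Z\<close>, so an \<open>(X, m)\<close>-isometry
  \<open>A\<close> with \<open>m \<ge> 1\<close> exhibits \<open>X\<close> as a linear combination of the operators \<open>A*\<^sup>k X A\<^sup>k\<close> with
  \<open>k \<ge> 1\<close>; consequently every operator that annihilates \<open>A*\<close> from the left annihilates \<open>X\<close> as well
  (\<open>annihilates_triangle_kernel\<close>). From \<open>A B = 0\<close> follows \<open>B* A* = 0\<close>, hence \<open>B* X = 0\<close>, and
  \<open>X B* = 0\<close> because \<open>B*\<close> commutes with \<open>X\<close>. The same principle, applied to the \<open>(Y, n)\<close>-isometry
  \<open>B\<close> and to the left factor \<open>X\<close>, turns \<open>X B* = 0\<close> into \<open>X Y = 0\<close>.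

  The identity \<open>(A B)* = B* A*\<close> relies on the adjoint, given by a definite description, to exist;
  this is where completeness of the space enters, through the Riesz representation theorem.
\<close>

text \<open>
  The representing vector is the minimiser of the functional \<open>J x = \<parallel>x\<parallel>\<^sup>2 - 2 f x\<close>, whose derivative
  at \<open>y\<close> in direction \<open>x\<close> is \<open>2 (\<langle>x, y\<rangle> - f x)\<close>. The parallelogram law makes minimising sequences
  Cauchy, so completeness supplies the minimiser without compactness.
\<close>

lemma riesz_representation_real:
  fixes f :: "'a::{real_inner, complete_space} \<Rightarrow> real"
  assumes f: "bounded_linear f"
  shows "\<exists>y. \<forall>x. f x = inner x y"
proof -
  interpret f: bounded_linear f by (rule f)
  define J where "J x = inner x x - 2 * f x" for x
  define \<mu> where "\<mu> = Inf (range J)"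
  obtain K where K: "\<And>x. norm (f x) \<le> norm x * K"
    using f.bounded by blast
  have "J x \<ge> - K\<^sup>2" for x
  proof -
    have "f x \<le> norm x * K"
      using K[of x] by simp
    moreover have "0 \<le> (norm x - K)\<^sup>2"
      by simp
    ultimately show ?thesis
      by (simp add: J_def power2_diff flip: power2_norm_eq_inner)
  qed
  then have bdd: "bdd_below (range J)"
    by (intro bdd_belowI[of _ "- K\<^sup>2"]) auto
  have \<mu>: "\<mu> \<le> J x" for x
    unfolding \<mu>_def by (rule cInf_lower[OF _ bdd]) simp
  have "\<exists>x. J x < \<mu> + 1 / real (Suc k)" for k
    using cInf_lessD[of "range J" "\<mu> + 1 / real (Suc k)"] by (auto simp: \<mu>_def)
  then obtain s where s: "\<And>k. J (s k) < \<mu> + 1 / real (Suc k)"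
    by metis
  have parallelogram: "(norm (x - y))\<^sup>2 = 2 * (J x + J y - 2 * J ((1/2) *\<^sub>R (x + y)))" for x y
    unfolding J_def power2_norm_eq_inner
    by (simp add: f.add f.scaleR inner_add_left inner_add_right inner_diff_left inner_diff_right
        inner_commute[of y x] field_simps)
  have "Cauchy s"
  proof (rule metric_CauchyI)
    fix e :: real
    assume e: "e > 0"
    obtain N where N: "inverse (real (Suc N)) < e\<^sup>2 / 4"
      using reals_Archimedean[of "e\<^sup>2 / 4"] e by auto
    have "dist (s i) (s j) < e" if "i \<ge> N" "j \<ge> N" for i j
    proof -
      have "1 / real (Suc i) \<le> inverse (real (Suc N))" "1 / real (Suc j) \<le> inverse (real (Suc N))"
        using that by (simp_all add: field_simps)
      then have "J (s i) < \<mu> + e\<^sup>2 / 4" "J (s j) < \<mu> + e\<^sup>2 / 4"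
        using s[of i] s[of j] N by argo+
      then have "(norm (s i - s j))\<^sup>2 < e\<^sup>2"
        using parallelogram[of "s i" "s j"] \<mu>[of "(1/2) *\<^sub>R (s i + s j)"] by argo
      then show ?thesis
        using e by (simp add: dist_norm power_less_imp_less_base)
    qed
    then show "\<exists>N. \<forall>i\<ge>N. \<forall>j\<ge>N. dist (s i) (s j) < e"
      by blast
  qed
  then obtain y where y: "s \<longlonglongrightarrow> y"
    using Cauchy_convergent convergent_def by blast
  have "(\<lambda>k. J (s k)) \<longlonglongrightarrow> J y"
    unfolding J_def by (intro tendsto_intros y f.tendsto)
  moreover have "(\<lambda>k. \<mu> + 1 / real (Suc k)) \<longlonglongrightarrow> \<mu> + 0"
    by (intro tendsto_intros LIMSEQ_Suc[OF lim_1_over_n])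
  ultimately have "J y \<le> \<mu> + 0"
    by (rule LIMSEQ_le) (use s in \<open>auto intro: less_imp_le\<close>)
  then have minimal: "J y \<le> J x" for x
    using \<mu>[of x] by linarith
  have "f x = inner x y" for x
  proof -
    define c where "c = inner x y - f x"
    \<comment> \<open>The derivative of \<open>t \<mapsto> J (y + t x)\<close> at 0 is \<open>2 c\<close>. Its minimum is at \<open>t = - c / \<parallel>x\<parallel>\<^sup>2\<close>; a larger
      denominator still gives a decrease and remains positive for \<open>x = 0\<close>.\<close>
    define a where "a = inner x x + 1"
    have a: "a > 0"
      by (simp add: a_def add_nonneg_pos)
    define t where "t = - c / a"
    have "J (y + t *\<^sub>R x) = J y + 2 * t * c + t\<^sup>2 * (a - 1)"
      by (simp add: J_def c_def a_def f.add f.scaleR inner_add_left inner_add_right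
          inner_commute[of y x] power2_eq_square algebra_simps)
    then have "0 \<le> 2 * t * c + t\<^sup>2 * (a - 1)"
      using minimal[of "y + t *\<^sub>R x"] by simp
    also have "\<dots> = - (c\<^sup>2 * (a + 1)) / a\<^sup>2"
      using a by (simp add: t_def field_simps power2_eq_square)
    finally have "c\<^sup>2 * (a + 1) \<le> 0"
      using a by (simp add: field_simps)
    then have "c = 0"
      using a by (simp add: mult_le_0_iff)
    then show ?thesis
      by (simp add: c_def)
  qed
  then show ?thesis
    by blast
qed

lemma Im_cinner_eq_inner: "Im (cinner x y) = inner ((- \<i>) *\<^sub>C x) y"
  by (simp only: inner_eq_Re_cinner cinner_scaleC_left) simp

lemma cinner_ext_right:
  assumes "\<And>x. cinner x u = cinner x v"
  shows "u = v"
  using assms by (metis inner_eq_Re_cinner vector_eq_ldot)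

lemma bounded_clinear_bop_apply: "bounded_clinear (bop_apply T)"
  using bop_apply by blast

lemma bop_eqI: "(\<And>x. bop_apply S x = bop_apply T x) \<Longrightarrow> S = T"
  by (metis bop_apply_inject ext)

text \<open>
  It suffices to represent the real functionals \<open>x \<mapsto> Re \<langle>T x, y\<rangle>\<close>: an imaginary part is the real part
  at the argument \<open>- i x\<close>, and \<open>T\<close> is complex-linear.
\<close>

lemma adjoint_exists:
  fixes T :: "'a::chilbert_space bop"
  shows "\<exists>S. \<forall>x y. cinner (bop_apply T x) y = cinner x (bop_apply S y)"
proof -
  have T: "bounded_linear (bop_apply T)" and TC: "\<And>c x. bop_apply T (c *\<^sub>C x) = c *\<^sub>C bop_apply T x"
    using bounded_clinear_bop_apply[of T] by (auto simp: bounded_clinear_def)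
  have "\<exists>z. \<forall>x. inner (bop_apply T x) y = inner x z" for y
    by (intro riesz_representation_real bounded_linear_compose[OF bounded_linear_inner_left T])
  then obtain g where g: "\<And>x y. inner (bop_apply T x) y = inner x (g y)"
    by metis
  have gC: "cinner (bop_apply T x) y = cinner x (g y)" for x y
  proof (rule complex_eqI)
    show "Re (cinner (bop_apply T x) y) = Re (cinner x (g y))"
      using g[of x y] by (simp add: inner_eq_Re_cinner)
    show "Im (cinner (bop_apply T x) y) = Im (cinner x (g y))"
      using g[of "(- \<i>) *\<^sub>C x" y] by (simp only: Im_cinner_eq_inner TC)
  qed
  have cinner_scaleC_right: "cinner x (c *\<^sub>C y) = cnj c * cinner x y" for c and x y :: 'a
    by (metis cinner_commute cinner_scaleC_left complex_cnj_mult)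
  obtain K where K: "\<And>x. norm (bop_apply T x) \<le> norm x * K"
    using bounded_linear.bounded[OF T] by blast
  have "bounded_linear g"
  proof (rule bounded_linear_intro)
    show "g (y + z) = g y + g z" for y z
      using g by (metis inner_add_right vector_eq_ldot)
    show "g (r *\<^sub>R y) = r *\<^sub>R g y" for r y
      using g by (metis inner_scaleR_right vector_eq_ldot)
    show "norm (g y) \<le> norm y * K" for y
    proof (cases "g y = 0")
      case True
      have "0 \<le> norm y * K"
        using K[of y] norm_ge_zero[of "bop_apply T y"] by linarith
      with True show ?thesis
        by simp
    next
      case False
      have "norm (g y) * norm (g y) = inner (bop_apply T (g y)) y"
        using g[of "g y" y] by (simp add: power2_norm_eq_inner flip: power2_eq_square)
      also have "\<dots> \<le> norm (bop_apply T (g y)) * norm y"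
        by (rule norm_cauchy_schwarz)
      also have "\<dots> \<le> norm (g y) * K * norm y"
        by (intro mult_right_mono K) simp
      finally show ?thesis
        using False by (simp add: mult_ac)
    qed
  qed
  moreover have "g (c *\<^sub>C y) = c *\<^sub>C g y" for c y
    by (rule cinner_ext_right) (simp add: cinner_scaleC_right flip: gC)
  ultimately have "bounded_clinear g"
    by (simp add: bounded_clinear_def)
  then have "bop_apply (Abs_bop g) = g"
    by (simp add: Abs_bop_inverse)
  with gC show ?thesis
    by metis
qed

lemma adj_eqI:
  assumes "\<And>x y. cinner (bop_apply T x) y = cinner x (bop_apply S y)"
  shows "adj T = S"
  unfolding adj_def
proof (rule the_equality)
  show "R = S" if "\<forall>x y. cinner (bop_apply T x) y = cinner x (bop_apply R y)" for R
    by (intro bop_eqI cinner_ext_right) (metis assms that)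
qed (use assms in blast)

lemma cinner_adj: "cinner (bop_apply T x) y = cinner x (bop_apply (adj T) y)"
  using adjoint_exists[of T] adj_eqI by metis

lemma adj_mult: "adj (S * T) = adj T * adj S"
  by (rule adj_eqI) (simp add: times_bop.rep_eq cinner_adj)

lemma adj_zero: "adj 0 = 0"
proof (rule adj_eqI)
  have "cinner 0 y = 0" "cinner x 0 = 0" for x y :: 'a
    by (simp_all add: complex_eq_iff Im_cinner_eq_inner flip: inner_eq_Re_cinner)
  then show "cinner (bop_apply 0 x) y = cinner x (bop_apply 0 y)" for x y :: 'a
    by (simp add: zero_bop.rep_eq)
qed

text \<open>
  Every summand of \<open>\<triangle>\<^sup>m\<close> other than the last begins with a factor \<open>S\<close>, so multiplication
  by \<open>R\<close> from the left leaves only \<open>\<plusminus>R Z\<close>.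
\<close>

lemma annihilates_triangle_kernel:
  assumes "R * S = 0" and "triangle_op m S T Z = 0"
  shows "R * Z = 0"
proof -
  have summand: "R * (S ^ (m - j) * Z * T ^ (m - j)) = 0" if "j < m" for j
  proof -
    have "R * S ^ (m - j) = 0"
      using that assms(1) by (cases "m - j") (auto simp: mult.assoc[symmetric])
    then show ?thesis
      by (simp add: mult.assoc[symmetric])
  qed
  have "0 = R * triangle_op m S T Z"
    using assms(2) by simp
  also have "\<dots> = (\<Sum>j=0..m. ((- 1) ^ j * real (m choose j)) *\<^sub>R
      (R * (S ^ (m - j) * Z * T ^ (m - j))))"
    by (simp add: triangle_op_def sum_distrib_left)
  also have "\<dots> = (\<Sum>j\<in>{m}. ((- 1) ^ j * real (m choose j)) *\<^sub>R
      (R * (S ^ (m - j) * Z * T ^ (m - j))))"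
    by (rule sum.mono_neutral_right) (auto simp: summand)
  also have "\<dots> = (- 1) ^ m *\<^sub>R (R * Z)"
    by simp
  finally show ?thesis
    by simp
qed

theorem theorem2p11:
  fixes A B X Y :: "'a::chilbert_space bop" and m n :: nat
  assumes infinite_dim: "\<not> (\<exists>S :: 'a set. finite S \<and> complex_vector.span S = UNIV)"
    and "m \<ge> 1" and "n \<ge> 1"
    and "drazin_invertible A" and "drazin_invertible B"
    and "m_isometric X m A" and "m_isometric Y n B"
    and "commutator X Y = 0" and "commutator A B = 0"
    and "commutator (adj A) Y = 0" and "commutator (adj B) X = 0"
    and "A * B = 0"
  shows "m_isometric (X * Y) (m + n - 1) (A + B) \<and>
    m_adjoint (X * Y) (m + n - 1) (adj (drazin_inverse (A + B))) (A + B)"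
proof -
  have "adj B * adj A = 0"
    using \<open>A * B = 0\<close> adj_zero by (metis adj_mult)
  then have "adj B * X = 0"
    using \<open>m_isometric X m A\<close> annihilates_triangle_kernel unfolding m_isometric_def by blast
  then have "X * adj B = 0"
    using \<open>commutator (adj B) X = 0\<close> by (simp add: commutator_def)
  then have "X * Y = 0"
    using \<open>m_isometric Y n B\<close> annihilates_triangle_kernel unfolding m_isometric_def by blast
  then show ?thesis
    by (simp add: m_isometric_def m_adjoint_def triangle_op_def delta_op_def)
qed

end
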